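(* Let $X$ be a quasisober space and let $U\subseteq X$ be an open subset. Then $U$ with the subspace topology is quasisober.
   Context: For a topological space $X$, the specialization preorder is $x\le y$ iff $x\in\mathrm{cl}\{y\}$; all order-theoretic notions in $X$ refer to it (for a subspace, to the specialization preorder of the subspace, with bounds taken inside the subspace). For $A\subseteq X$, $A^{\uparrow}$ and $A^{\downarrow}$ denote the sets of all upper, respectively lower, bounds of $A$ in $X$, and $A^{\delta}=(A^{\uparrow})^{\downarrow}$ is the cut closure of $A$. Directed sets and irreducible closed sets are nonempty. $X$ is quasisober if it is $T_0$ and every irreducible closed subset of $X$ equals $D^{\delta}$ for some directed subset $D$ of $X$. *)

theory Defs
  imports "HOL-Analysis.Analysis"
begin

(* The specialization preorder. Both arguments are forced to lie in the space, since
   the closure of a singleton outside topspace X is empty. *)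
definition spec_le :: "'a topology \<Rightarrow> 'a \<Rightarrow> 'a \<Rightarrow> bool"
  where "spec_le X x y \<longleftrightarrow> x \<in> X closure_of {y}"

(* Bounds are taken inside topspace X, so the bounds of the empty set form topspace X. *)
definition upper_bounds :: "'a topology \<Rightarrow> 'a set \<Rightarrow> 'a set"
  where "upper_bounds X A = {u \<in> topspace X. \<forall>a\<in>A. spec_le X a u}"

definition lower_bounds :: "'a topology \<Rightarrow> 'a set \<Rightarrow> 'a set"
  where "lower_bounds X A = {l \<in> topspace X. \<forall>a\<in>A. spec_le X l a}"

definition cut_closure :: "'a topology \<Rightarrow> 'a set \<Rightarrow> 'a set"
  where "cut_closure X A = lower_bounds X (upper_bounds X A)"

definition directed_in :: "'a topology \<Rightarrow> 'a set \<Rightarrow> bool"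
  where "directed_in X D \<longleftrightarrow>
    D \<subseteq> topspace X \<and> D \<noteq> {} \<and> (\<forall>x\<in>D. \<forall>y\<in>D. \<exists>z\<in>D. spec_le X x z \<and> spec_le X y z)"

definition irreducible_closedin :: "'a topology \<Rightarrow> 'a set \<Rightarrow> bool"
  where "irreducible_closedin X F \<longleftrightarrow>
    closedin X F \<and> F \<noteq> {} \<and>
    (\<forall>A B. closedin X A \<and> closedin X B \<and> F = A \<union> B \<longrightarrow> F = A \<or> F = B)"

definition quasisober_space :: "'a topology \<Rightarrow> bool"
  where "quasisober_space X \<longleftrightarrow>
    t0_space X \<and>
    (\<forall>F. irreducible_closedin X F \<longrightarrow> (\<exists>D. directed_in X D \<and> F = cut_closure X D))"

end

(* In a quasisober space the closure of a directed set D is irreducible, hence a cut, and D has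
   the same upper bounds as its closure; so the cut closure of D is just its closure.
   Given F irreducible closed in the open set U, the closure of F in X is therefore the closure of
   some directed D. Then D meets U, and since U is an upper set, the intersection of D with U is
   cofinal in D, so it has the same upper bounds, all of which lie in U. Hence its cut closure
   in U is F. *)

theory Submission
  imports Defs
begin

lemma spec_le_trans: "spec_le X x y \<Longrightarrow> spec_le X y z \<Longrightarrow> spec_le X x z"
  by (auto simp: spec_le_def in_closure_of)

lemma spec_le_openin: "spec_le X x y \<Longrightarrow> openin X U \<Longrightarrow> x \<in> U \<Longrightarrow> y \<in> U"
  by (auto simp: spec_le_def in_closure_of)

lemma spec_le_closedin: "spec_le X x y \<Longrightarrow> closedin X C \<Longrightarrow> y \<in> C \<Longrightarrow> x \<in> C"
  unfolding spec_le_def by (meson closure_of_minimal empty_subsetI insert_subset subsetD)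

lemma spec_le_subtopology:
  "spec_le (subtopology X U) x y \<longleftrightarrow> x \<in> U \<and> y \<in> U \<and> spec_le X x y"
  by (auto simp: spec_le_def in_closure_of openin_subtopology)

text \<open>A point \<open>u\<close> bounds \<open>A\<close> from above exactly when the closed set
  \<open>X closure_of {u}\<close> contains \<open>A\<close>, and a closed set containing
  \<open>A\<close> contains its closure.\<close>

lemma upper_bounds_closure_of:
  assumes "A \<subseteq> topspace X"
  shows "upper_bounds X (X closure_of A) = upper_bounds X A"
proof -
  have "X closure_of A \<subseteq> X closure_of {u} \<longleftrightarrow> A \<subseteq> X closure_of {u}" for u
    using assms by (meson closedin_closure_of closure_of_minimal closure_of_subset order_trans)
  then show ?thesis
    by (auto simp: upper_bounds_def spec_le_def)
qed

text \<open>Upper and lower bounds form an antitone Galois connection, so passing up, down and up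
  again gives the same set as passing up once.\<close>

lemma upper_bounds_cut_closure:
  assumes "A \<subseteq> topspace X"
  shows "upper_bounds X (cut_closure X A) = upper_bounds X A"
  using assms by (auto simp: cut_closure_def upper_bounds_def lower_bounds_def)

lemma irreducible_closedin_closure_of_directed:
  assumes "directed_in X D"
  shows "irreducible_closedin X (X closure_of D)"
proof -
  have D: "D \<subseteq> topspace X" "D \<noteq> {}"
    and dir: "\<And>x y. x \<in> D \<Longrightarrow> y \<in> D \<Longrightarrow> \<exists>z\<in>D. spec_le X x z \<and> spec_le X y z"
    using assms by (auto simp: directed_in_def)
  have "X closure_of D = A \<or> X closure_of D = B"
    if A: "closedin X A" and B: "closedin X B" and eq: "X closure_of D = A \<union> B" for A B
  proof -
    have "D \<subseteq> A \<or> D \<subseteq> B"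
    proof (rule ccontr)
      assume "\<not> (D \<subseteq> A \<or> D \<subseteq> B)"
      \<comment> \<open>Closed sets are lower sets, so a common upper bound of \<open>a\<close> and
        \<open>b\<close> can lie neither in \<open>A\<close> nor in \<open>B\<close>.\<close>
      then obtain a b where ab: "a \<in> D" "a \<notin> A" "b \<in> D" "b \<notin> B"
        by blast
      then obtain z where z: "z \<in> D" "spec_le X a z" "spec_le X b z"
        using dir by blast
      then have "z \<in> A \<union> B"
        using closure_of_subset[OF D(1)] eq by blast
      then show False
        using z ab A B spec_le_closedin by (metis UnE)
    qed
    then have "X closure_of D \<subseteq> A \<or> X closure_of D \<subseteq> B"
      using A B closure_of_minimal by metis
    then show ?thesis
      using eq by blast
  qed
  moreover have "X closure_of D \<noteq> {}"
    using D closure_of_subset by blast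
  ultimately show ?thesis
    by (auto simp: irreducible_closedin_def)
qed

text \<open>A splitting of the closure into two closed sets leaves a splitting of \<open>F\<close>
  as its trace on \<open>U\<close>. The part that then contains \<open>F\<close> is closed in
  \<open>X\<close>, so it contains the whole closure.\<close>

lemma irreducible_closedin_closure_of_subtopology:
  assumes "irreducible_closedin (subtopology X U) F"
  shows "irreducible_closedin X (X closure_of F)"
proof -
  have cl: "closedin (subtopology X U) F" and ne: "F \<noteq> {}"
    and irr: "\<And>A B. closedin (subtopology X U) A \<Longrightarrow> closedin (subtopology X U) B \<Longrightarrow>
      F = A \<union> B \<Longrightarrow> F = A \<or> F = B"
    using assms by (auto simp: irreducible_closedin_def)
  have F: "F \<subseteq> topspace X" "F \<subseteq> U"
    using closedin_subset[OF cl] by auto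
  \<comment> \<open>\<open>F\<close> is its own closure in the subspace, and that closure is the
    trace on \<open>U\<close> of the closure in \<open>X\<close>.\<close>
  have F_eq: "F = U \<inter> X closure_of F"
    using cl by (metis closure_of_closedin closure_of_subtopology F(2) inf.absorb2)
  have "X closure_of F = A \<or> X closure_of F = B"
    if A: "closedin X A" and B: "closedin X B" and eq: "X closure_of F = A \<union> B" for A B
  proof -
    have "F = U \<inter> A \<union> U \<inter> B"
      using F_eq eq by blast
    moreover have "closedin (subtopology X U) (U \<inter> A)" "closedin (subtopology X U) (U \<inter> B)"
      using A B by (auto simp: closedin_subtopology)
    ultimately have "F \<subseteq> A \<or> F \<subseteq> B"
      using irr by blast
    then have "X closure_of F \<subseteq> A \<or> X closure_of F \<subseteq> B"
      using A B closure_of_minimal by metis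
    then show ?thesis
      using eq by blast
  qed
  moreover have "X closure_of F \<noteq> {}"
    using F ne closure_of_subset by blast
  ultimately show ?thesis
    by (auto simp: irreducible_closedin_def)
qed

text \<open>Quasisobriety supplies a possibly different directed set \<open>E\<close> whose cut is
  the closure of \<open>D\<close>. Both \<open>D\<close> and \<open>E\<close> share their upper
  bounds with this common set, and a cut closure depends only on the upper bounds.\<close>

lemma cut_closure_directed_quasisober:
  assumes "quasisober_space X" "directed_in X D"
  shows "cut_closure X D = X closure_of D"
proof -
  obtain E where E: "directed_in X E" "X closure_of D = cut_closure X E"
    using assms irreducible_closedin_closure_of_directed unfolding quasisober_space_def by blast
  have DE: "D \<subseteq> topspace X" "E \<subseteq> topspace X"
    using assms(2) E(1) by (auto simp: directed_in_def)
  have "upper_bounds X D = upper_bounds X E"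
    using upper_bounds_closure_of[OF DE(1)] upper_bounds_cut_closure[OF DE(2)] E(2) by simp
  then show ?thesis
    using E(2) by (simp add: cut_closure_def)
qed

lemma directed_in_Int_openin:
  assumes "directed_in X D" "openin X U" "D \<inter> U \<noteq> {}"
  shows "directed_in (subtopology X U) (D \<inter> U)"
  unfolding directed_in_def spec_le_subtopology
proof (intro conjI ballI)
  show "D \<inter> U \<subseteq> topspace (subtopology X U)"
    using assms(1) by (auto simp: directed_in_def)
  fix x y assume xy: "x \<in> D \<inter> U" "y \<in> D \<inter> U"
  then obtain z where "z \<in> D" "spec_le X x z" "spec_le X y z"
    using assms(1) unfolding directed_in_def by blast
  then show "\<exists>z\<in>D \<inter> U. (x \<in> U \<and> z \<in> U \<and> spec_le X x z) \<and> y \<in> U \<and> z \<in> U \<and> spec_le X y z"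
    using xy spec_le_openin[OF _ assms(2)] by blast
qed (use assms(3) in blast)

lemma upper_bounds_directed_Int_openin:
  assumes "directed_in X D" "openin X U" "D \<inter> U \<noteq> {}"
  shows "upper_bounds (subtopology X U) (D \<inter> U) = upper_bounds X D"
proof
  \<comment> \<open>Everything above \<open>d\<close> lies in \<open>U\<close>, since open sets are
    upper sets; in particular all upper bounds of \<open>D\<close> do.\<close>
  obtain d where d: "d \<in> D" "d \<in> U"
    using assms(3) by blast
  show "upper_bounds X D \<subseteq> upper_bounds (subtopology X U) (D \<inter> U)"
    using d spec_le_openin[OF _ assms(2)]
    by (auto simp: upper_bounds_def spec_le_subtopology)
  show "upper_bounds (subtopology X U) (D \<inter> U) \<subseteq> upper_bounds X D"
  proof
    fix u assume u: "u \<in> upper_bounds (subtopology X U) (D \<inter> U)"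
    have "spec_le X x u" if "x \<in> D" for x
    proof -
      \<comment> \<open>Pairing \<open>x\<close> with \<open>d\<close> forces the common bound
        \<open>z\<close> into \<open>U\<close>, so that \<open>u\<close> lies above \<open>z\<close>
        and hence above \<open>x\<close>.\<close>
      obtain z where z: "z \<in> D" "spec_le X x z" "spec_le X d z"
        using assms(1) d \<open>x \<in> D\<close> unfolding directed_in_def by blast
      then have "z \<in> D \<inter> U"
        using d spec_le_openin[OF _ assms(2)] by blast
      then have "spec_le X z u"
        using u by (auto simp: upper_bounds_def spec_le_subtopology)
      then show ?thesis
        using z spec_le_trans by metis
    qed
    then show "u \<in> upper_bounds X D"
      using u by (auto simp: upper_bounds_def)
  qed
qed

text \<open>The two sets of upper bounds agree and lie in \<open>U\<close>, and the lower bounds of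
  a subset of \<open>U\<close> in the subspace are its lower bounds in \<open>X\<close> that belong
  to \<open>U\<close>.\<close>

lemma cut_closure_directed_Int_openin:
  assumes "directed_in X D" "openin X U" "D \<inter> U \<noteq> {}"
  shows "cut_closure (subtopology X U) (D \<inter> U) = U \<inter> cut_closure X D"
proof -
  have "upper_bounds X D \<subseteq> U"
    using upper_bounds_directed_Int_openin[OF assms] by (auto simp: upper_bounds_def)
  then show ?thesis
    unfolding cut_closure_def upper_bounds_directed_Int_openin[OF assms]
    by (auto simp: lower_bounds_def spec_le_subtopology)
qed

theorem proposition3p5:
  fixes X :: "'a topology" and U :: "'a set"
  assumes "quasisober_space X"
    and "openin X U"
  shows "quasisober_space (subtopology X U)"
  unfolding quasisober_space_def
proof (intro conjI allI impI)
  show "t0_space (subtopology X U)"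
    using assms(1) by (simp add: quasisober_space_def t0_space_subtopology)
next
  fix F assume F: "irreducible_closedin (subtopology X U) F"
  then have cl: "closedin (subtopology X U) F" and ne: "F \<noteq> {}"
    by (auto simp: irreducible_closedin_def)
  have "F \<subseteq> U"
    using closedin_subset[OF cl] by auto
  then have F_eq: "F = U \<inter> X closure_of F"
    using cl by (metis closure_of_closedin closure_of_subtopology inf.absorb2)
  obtain D where D: "directed_in X D" "X closure_of F = cut_closure X D"
    using assms(1) irreducible_closedin_closure_of_subtopology[OF F]
    unfolding quasisober_space_def by blast
  \<comment> \<open>Replacing the cut by a closure is what makes \<open>D\<close> reach
    \<open>U\<close>: an open set that meets the closure of \<open>D\<close> meets \<open>D\<close>
    itself.\<close>
  then have "X closure_of D = X closure_of F"
    using cut_closure_directed_quasisober[OF assms(1)] by metis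
  then have "U \<inter> X closure_of D \<noteq> {}"
    using F_eq ne by simp
  then have "D \<inter> U \<noteq> {}"
    using openin_Int_closure_of_eq_empty[OF assms(2)] by blast
  \<comment> \<open>The witness is \<open>D \<inter> U\<close>, whose cut closure in the subspace is
    \<open>U \<inter> X closure_of F\<close>.\<close>
  then show "\<exists>D. directed_in (subtopology X U) D \<and> F = cut_closure (subtopology X U) D"
    using directed_in_Int_openin cut_closure_directed_Int_openin D assms(2) F_eq by metis
qed

end
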